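(* Let $q=p^k$ with $p$ prime and $k\ge 1$, and let $s\ge 1$ and $n\ge 1$. For $1\le i\le s$, let $B_i\in\mathbb{F}_q^{m_i\times n}$ be an $m_i\times n$ matrix with linearly independent rows, and let $t_i$ be a nonnegative integer. For each $i,j$ with $1\le i\le s$ and $1\le j\le m_i$, choose a set $T_{ij}\subseteq\mathbb{F}_q$ with $|T_{ij}|\le t_i$. If \[ t_1+\cdots+t_s\le k, \] then there is an $x\in\mathbb{F}_q^n$ such that \[ (B_ix)_j\notin T_{ij}\qquad(1\le i\le s,\ 1\le j\le m_i). \]
   Context: $\mathbb{F}_q$ is the finite field with $q$ elements, and $(B_ix)_j$ denotes the $j$-th coordinate of the vector $B_ix\in\mathbb{F}_q^{m_i}$. *)

theory Defs
  imports "Jordan_Normal_Form.VS_Connect" "HOL-Computational_Algebra.Primes"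
    "HOL-Library.Cardinality"
begin

(* lin_dep speaks about a set of vectors, so distinctness is needed to view the rows
   as a family: a matrix with a repeated row has linearly dependent rows. *)
definition lin_indpt_rows :: "'a::field mat \<Rightarrow> bool" where
  "lin_indpt_rows A \<longleftrightarrow>
     distinct (rows A) \<and>
     \<not> module.lin_dep class_ring (module_vec TYPE('a) (dim_col A)) (set (rows A))"

end

theory Submission
  imports Defs "HOL-Library.Function_Algebras"
begin

text \<open>
  Since the \<open>t i\<close> sum to at most \<open>k\<close>, the pairs \<open>(i, r)\<close> with \<open>r < t i\<close> receive distinct exponents
  \<open>e i r\<close> in \<open>{0, \<dots>, k - 1}\<close>. The condition \<open>(B i x)\<^sub>j \<noteq> c\<close> is equivalent to
  \<open>(B i x)\<^sub>j ^ (p ^ e) \<noteq> c ^ (p ^ e)\<close>, whose left-hand side is an additive function of \<open>x\<close>.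
  These additive functions have a dual system of formal combinations of vectors: linear
  independence of the rows separates different \<open>j\<close>, and linear independence of the monomials
  \<open>X ^ (p ^ e)\<close>, of degree less than \<open>q\<close>, separates different \<open>e\<close>. Differencing along the dual
  combinations strips the factors from the product of all the functions
  \<open>(B i x)\<^sub>j ^ (p ^ e) - c ^ (p ^ e)\<close> one by one, up to terms of lower degree, so this product is
  not the zero function.
\<close>

section \<open>Degree measured by iterated differences\<close>

text \<open>Vanishing of all \<open>d\<close>-fold differences replaces a bound on the algebraic
  degree: \<open>y ^ (p ^ e)\<close> has large algebraic degree in \<open>y\<close>, but being
  additive it counts as linear here.\<close>

primrec deg_lt :: "nat \<Rightarrow> ('v::plus \<Rightarrow> 'a::comm_ring_1) \<Rightarrow> bool" where
  "deg_lt 0 f \<longleftrightarrow> (\<forall>x. f x = 0)"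
| "deg_lt (Suc d) f \<longleftrightarrow> (\<forall>v. deg_lt d (\<lambda>x. f (x + v) - f x))"

lemma deg_lt_zero: "deg_lt d (\<lambda>x. 0)"
  by (induction d) auto

lemma deg_lt_add:
  assumes "deg_lt d f" "deg_lt d g"
  shows "deg_lt d (\<lambda>x. f x + g x)"
  using assms
proof (induction d arbitrary: f g)
  case (Suc d)
  show ?case
  proof (simp, intro allI)
    fix v
    have "deg_lt d (\<lambda>x. (f (x + v) - f x) + (g (x + v) - g x))"
      using Suc by simp
    then show "deg_lt d (\<lambda>x. f (x + v) + g (x + v) - (f x + g x))"
      by (simp add: algebra_simps)
  qed
qed simp

lemma deg_lt_cmult:
  assumes "deg_lt d f"
  shows "deg_lt d (\<lambda>x. c * f x)"
  using assms
proof (induction d arbitrary: f)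
  case (Suc d)
  then have "deg_lt d (\<lambda>x. c * (f (x + v) - f x))" for v
    by simp
  then show ?case by (simp add: algebra_simps)
qed simp

lemma deg_lt_diff:
  assumes "deg_lt d f" "deg_lt d g"
  shows "deg_lt d (\<lambda>x. f x - g x)"
  using deg_lt_add[OF assms(1) deg_lt_cmult[OF assms(2), of "-1"]] by simp

lemma deg_lt_sum:
  assumes "\<And>i. i \<in> I \<Longrightarrow> deg_lt d (f i)"
  shows "deg_lt d (\<lambda>x. \<Sum>i\<in>I. f i x)"
  using assms
  by (induction I rule: infinite_finite_induct) (auto intro: deg_lt_zero deg_lt_add)

lemma deg_lt_Suc:
  assumes "deg_lt d f"
  shows "deg_lt (Suc d) f"
  using assms by (induction d arbitrary: f) auto

text \<open>With D the difference along \<open>v\<close>, D(f g) = (D f) g + A v (f + D f). The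
  induction hypothesis applies to the first term, since D f has a bound smaller by one.\<close>

lemma deg_lt_mult_additive:
  assumes shift: "\<And>x v. g (x + v) = g x + A v"
    and "deg_lt d f"
  shows "deg_lt (Suc d) (\<lambda>x. f x * g x)"
  using assms(2)
proof (induction d arbitrary: f)
  case (Suc d)
  have "deg_lt (Suc d) (\<lambda>x. f (x + v) * g (x + v) - f x * g x)" for v
  proof -
    have df: "deg_lt d (\<lambda>x. f (x + v) - f x)" using Suc.prems by simp
    have "deg_lt (Suc d) (\<lambda>x. (f (x + v) - f x) * g x
             + (A v * f x + A v * (f (x + v) - f x)))"
      by (intro deg_lt_add deg_lt_cmult Suc.IH[OF df] Suc.prems deg_lt_Suc[OF df])
    moreover have "(f (x + v) - f x) * g x + (A v * f x + A v * (f (x + v) - f x))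
             = f (x + v) * g (x + v) - f x * g x" for x
      by (simp add: shift algebra_simps)
    ultimately show ?thesis by (simp only:)
  qed
  then show ?case by (subst deg_lt.simps) blast
qed simp

lemma deg_lt_prod_additive:
  assumes "finite S" and "\<And>a x v. a \<in> S \<Longrightarrow> f a (x + v) = f a x + A a v"
  shows "deg_lt (Suc (card S)) (\<lambda>x. \<Prod>a\<in>S. f a x)"
  using assms
proof (induction S rule: finite_induct)
  case (insert b S)
  have "deg_lt (Suc (Suc (card S))) (\<lambda>x. (\<Prod>a\<in>S. f a x) * f b x)"
    by (rule deg_lt_mult_additive[where A = "A b"]) (use insert in auto)
  then show ?case using insert.hyps by (simp add: mult.commute del: deg_lt.simps)
qed simp

section \<open>Weighted differences of products of affine functions\<close>

text \<open>Product rule for a weighted difference: the three sums come from differencing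
  \<open>h\<close> alone, \<open>g\<close> alone, and both.\<close>

lemma weighted_diff_prod:
  fixes g h :: "'v::plus \<Rightarrow> 'a::comm_ring_1" and \<beta> :: "'i \<Rightarrow> 'a"
  assumes "\<And>x v. g (x + v) = g x + A v"
  shows "(\<Sum>i\<in>I. \<beta> i * (h (x + w i) * g (x + w i) - h x * g x))
       = (\<Sum>i\<in>I. \<beta> i * (h (x + w i) - h x)) * g x
         + (\<Sum>i\<in>I. \<beta> i * A (w i)) * h x
         + (\<Sum>i\<in>I. \<beta> i * A (w i) * (h (x + w i) - h x))"
  unfolding sum_distrib_right sum.distrib[symmetric]
  by (rule sum.cong) (simp_all add: assms algebra_simps)

text \<open>A difference lowers the bound \<open>card S + 1\<close> of the product by one. Weights
  annihilating every \<open>A a\<close> gain one more, because the middle sum of the product rule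
  vanishes.\<close>

lemma weighted_diff_deg_lt:
  assumes "finite S" and "\<And>a x v. a \<in> S \<Longrightarrow> f a (x + v) = f a x + A a v"
    and "\<And>a. a \<in> S \<Longrightarrow> (\<Sum>i\<in>I. \<beta> i * A a (w i)) = 0"
  shows "deg_lt (card S - 1)
           (\<lambda>x. \<Sum>i\<in>I. \<beta> i * ((\<Prod>a\<in>S. f a (x + w i)) - (\<Prod>a\<in>S. f a x)))"
  using assms
proof (induction S rule: finite_induct)
  case (insert b S)
  let ?h = "\<lambda>x. \<Prod>a\<in>S. f a x"
  have eq: "(\<Sum>i\<in>I. \<beta> i * ((\<Prod>a\<in>insert b S. f a (x + w i)) - (\<Prod>a\<in>insert b S. f a x)))
      = (\<Sum>i\<in>I. \<beta> i * (?h (x + w i) - ?h x)) * f b x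
        + (\<Sum>i\<in>I. \<beta> i * A b (w i) * (?h (x + w i) - ?h x))" for x
    using weighted_diff_prod[where g = "f b" and A = "A b" and I = I and \<beta> = \<beta> and h = ?h and x = x and w = w] insert
    by (simp add: mult.commute)
  show ?case
  \<comment> \<open>A single factor is treated apart: there \<open>card S - 1\<close> is truncated,
    and multiplying by \<open>f b\<close> would give only \<open>deg_lt 1\<close>, while the
    weighted difference is in fact zero.\<close>
  proof (cases "S = {}")
    case True
    then show ?thesis using insert.prems by simp
  next
    case False
    then obtain m where m: "card S = Suc m"
      using insert.hyps by (metis card_eq_0_iff not0_implies_Suc)
    have 1: "deg_lt m (\<lambda>x. \<Sum>i\<in>I. \<beta> i * (?h (x + w i) - ?h x))"
      using insert.IH insert.prems m by simp
    have 2: "deg_lt (card S) (\<lambda>x. ?h (x + w i) - ?h x)" for i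
      using deg_lt_prod_additive[of S f A] insert by auto
    have "deg_lt (Suc m) (\<lambda>x. (\<Sum>i\<in>I. \<beta> i * (?h (x + w i) - ?h x)) * f b x
        + (\<Sum>i\<in>I. \<beta> i * A b (w i) * (?h (x + w i) - ?h x)))"
      by (intro deg_lt_add deg_lt_sum deg_lt_cmult deg_lt_mult_additive[OF _ 1, where A = "A b"])
        (use insert 2 m in auto)
    then show ?thesis unfolding eq using insert.hyps m by simp
  qed
qed simp

text \<open>Differencing along the combination dual to \<open>b\<close> turns the product into the
  product without \<open>f b\<close>, modulo terms satisfying \<open>deg_lt (card S)\<close>. The
  empty product 1 starts the induction.\<close>

lemma prod_additive_not_deg_lt:
  fixes f :: "'b \<Rightarrow> 'v::plus \<Rightarrow> 'a::comm_ring_1"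
  assumes "finite S" and "\<And>a x v. a \<in> S \<Longrightarrow> f a (x + v) = f a x + A a v"
    and "\<And>a. a \<in> S \<Longrightarrow> \<exists>(I::'i set) \<beta> w. \<forall>b\<in>S.
           (\<Sum>i\<in>I. \<beta> i * A b (w i)) = (if b = a then 1 else 0)"
  shows "\<not> deg_lt (card S) (\<lambda>x. \<Prod>a\<in>S. f a x)"
  using assms
proof (induction S rule: finite_induct)
  case (insert b S)
  let ?h = "\<lambda>x. \<Prod>a\<in>S. f a x"
  obtain I :: "'i set" and \<beta> w where dual: "\<forall>a\<in>insert b S.
      (\<Sum>i\<in>I. \<beta> i * A a (w i)) = (if a = b then 1 else 0)"
    using insert.prems(2)[of b] by blast
  have dual0: "(\<Sum>i\<in>I. \<beta> i * A a (w i)) = 0" if "a \<in> S" for a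
    using that dual insert.hyps(2) by auto
  have not_h: "\<not> deg_lt (card S) ?h"
  proof (rule insert.IH)
    fix a assume "a \<in> S"
    then show "\<exists>(I::'i set) \<beta> w. \<forall>b\<in>S. (\<Sum>i\<in>I. \<beta> i * A b (w i)) = (if b = a then 1 else 0)"
      using insert.prems(2)[of a] by (meson insertCI)
  qed (use insert.prems in auto)
  show ?case
  proof
    assume "deg_lt (card (insert b S)) (\<lambda>x. \<Prod>a\<in>insert b S. f a x)"
    then have "deg_lt (Suc (card S)) (\<lambda>x. ?h x * f b x)"
      using insert.hyps by (simp add: mult.commute del: deg_lt.simps)
    then have 1: "deg_lt (card S) (\<lambda>x. \<Sum>i\<in>I. \<beta> i * (?h (x + w i) * f b (x + w i) - ?h x * f b x))"
      by (intro deg_lt_sum deg_lt_cmult) auto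
    \<comment> \<open>The weights give \<open>A b\<close> the value 1, so the middle sum of the
      product rule is \<open>?h\<close> itself.\<close>
    have eq: "(\<Sum>i\<in>I. \<beta> i * (?h (x + w i) * f b (x + w i) - ?h x * f b x))
      = (\<Sum>i\<in>I. \<beta> i * (?h (x + w i) - ?h x)) * f b x + ?h x
        + (\<Sum>i\<in>I. \<beta> i * A b (w i) * (?h (x + w i) - ?h x))" for x
      using weighted_diff_prod[where g = "f b" and A = "A b" and I = I and \<beta> = \<beta> and h = ?h and x = x and w = w] insert.prems dual by simp
    have 2: "deg_lt (card S) (\<lambda>x. \<Sum>i\<in>I. \<beta> i * A b (w i) * (?h (x + w i) - ?h x))"
      by (intro deg_lt_sum deg_lt_cmult)
        (use deg_lt_prod_additive[of S f A] insert in auto)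
    \<comment> \<open>The weights annihilate \<open>A a\<close> for \<open>a\<close> in
      \<open>S\<close>, so the weighted difference of \<open>?h\<close> has a bound low enough to
      absorb the factor \<open>f b\<close>.\<close>
    have 3: "deg_lt (card S) (\<lambda>x. (\<Sum>i\<in>I. \<beta> i * (?h (x + w i) - ?h x)) * f b x)"
    proof (cases "S = {}")
      case True
      then show ?thesis by simp
    next
      case False
      then obtain m where m: "card S = Suc m"
        using insert.hyps by (metis card_eq_0_iff not0_implies_Suc)
      have "deg_lt (card S - 1) (\<lambda>x. \<Sum>i\<in>I. \<beta> i * (?h (x + w i) - ?h x))"
        by (rule weighted_diff_deg_lt[where A = A]) (use insert dual0 in auto)
      then show ?thesis
        unfolding m by (intro deg_lt_mult_additive[where A = "A b"]) (use insert in auto)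
    qed
    have "deg_lt (card S) ?h"
      using deg_lt_diff[OF deg_lt_diff[OF 1 2] 3] unfolding eq by simp
    with not_h show False by contradiction
  qed
qed simp

text \<open>If every \<open>x\<close> hit some \<open>c a\<close>, the product of the differences
  would be the zero function, which satisfies every degree bound.\<close>

lemma additive_avoids_values:
  fixes A :: "'b \<Rightarrow> 'v::plus \<Rightarrow> 'a::idom"
  assumes "finite S" and "\<And>a x v. a \<in> S \<Longrightarrow> A a (x + v) = A a x + A a v"
    and "\<And>a. a \<in> S \<Longrightarrow> \<exists>(I::'i set) \<beta> w. \<forall>b\<in>S.
           (\<Sum>i\<in>I. \<beta> i * A b (w i)) = (if b = a then 1 else 0)"
  shows "\<exists>x. \<forall>a\<in>S. A a x \<noteq> c a"
proof -
  have "\<not> deg_lt (card S) (\<lambda>x. \<Prod>a\<in>S. A a x - c a)"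
  proof (rule prod_additive_not_deg_lt[where A = A])
    show "A a (x + v) - c a = A a x - c a + A a v" if "a \<in> S" for a x v
      using assms(2)[OF that] by simp
    show "\<exists>(I::'i set) \<beta> w. \<forall>b\<in>S. (\<Sum>i\<in>I. \<beta> i * A b (w i)) = (if b = a then 1 else 0)"
      if "a \<in> S" for a
      using assms(3)[OF that] .
  qed (rule assms(1))
  moreover have "deg_lt (card S) (\<lambda>x. \<Prod>a\<in>S. A a x - c a)"
    if "\<And>x. (\<Prod>a\<in>S. A a x - c a) = 0"
    unfolding that by (rule deg_lt_zero)
  ultimately obtain x where "(\<Prod>a\<in>S. A a x - c a) \<noteq> 0"
    by blast
  then show ?thesis using assms(1) by auto
qed

section \<open>Dual vectors of linearly independent families\<close>

text \<open>Induction in the manner of Gram-Schmidt: a vector orthogonal to the old rows but not to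
  the new one yields the new dual vector and corrects the old ones.\<close>

lemma dual_vector_exists:
  fixes r :: "'b \<Rightarrow> 'i \<Rightarrow> 'a::field"
  assumes "finite I" "finite S"
    and "\<And>c. (\<And>i. i \<in> I \<Longrightarrow> (\<Sum>b\<in>S. c b * r b i) = 0) \<Longrightarrow> \<forall>b\<in>S. c b = 0"
    and "a \<in> S"
  shows "\<exists>x. \<forall>b\<in>S. (\<Sum>i\<in>I. r b i * x i) = (if b = a then 1 else 0)"
  using assms(2-)
proof (induction S arbitrary: a rule: finite_induct)
  case (insert a S d)
  have "\<exists>x. \<forall>b\<in>S. (\<Sum>i\<in>I. r b i * x i) = (if b = b' then 1 else 0)" if "b' \<in> S" for b'
  proof (rule insert.IH[OF _ that])
    fix c assume c: "\<And>i. i \<in> I \<Longrightarrow> (\<Sum>b\<in>S. c b * r b i) = 0"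
    have "\<forall>b\<in>insert a S. (c(a := 0)) b = 0"
    proof (rule insert.prems(1))
      fix i assume "i \<in> I"
      have "(\<Sum>b\<in>S. (c(a := 0)) b * r b i) = (\<Sum>b\<in>S. c b * r b i)"
        by (rule sum.cong) (use insert.hyps in auto)
      then show "(\<Sum>b\<in>insert a S. (c(a := 0)) b * r b i) = 0"
        using c[OF \<open>i \<in> I\<close>] insert.hyps by simp
    qed
    then show "\<forall>b\<in>S. c b = 0" using insert.hyps(2) by (metis fun_upd_other insertCI)
  qed
  then obtain u where u: "\<And>b b'. b \<in> S \<Longrightarrow> b' \<in> S \<Longrightarrow>
      (\<Sum>i\<in>I. r b i * u b' i) = (if b = b' then 1 else 0)"
    by metis
  \<comment> \<open>If row \<open>a\<close> were a combination of the rows in \<open>S\<close>, its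
    coefficients would be these \<open>c b\<close>. By independence it differs from that combination
    in some coordinate \<open>i0\<close>.\<close>
  define c where "c b = (\<Sum>i\<in>I. r a i * u b i)" for b
  have "\<exists>i\<in>I. (\<Sum>b\<in>insert a S. (if b = a then 1 else - c b) * r b i) \<noteq> 0"
    using insert.prems(1)[of "\<lambda>b. if b = a then 1 else - c b"] by fastforce
  then obtain i0 where i0: "i0 \<in> I"
    and "(\<Sum>b\<in>insert a S. (if b = a then 1 else - c b) * r b i0) \<noteq> 0"
    by blast
  moreover have "(\<Sum>b\<in>S. (if b = a then 1 else - c b) * r b i0) = - (\<Sum>b\<in>S. c b * r b i0)"
    unfolding sum_negf[symmetric] by (rule sum.cong) (use insert.hyps in auto)
  ultimately have g: "r a i0 - (\<Sum>b\<in>S. c b * r b i0) \<noteq> 0" (is "?g \<noteq> 0")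
    using insert.hyps by simp
  \<comment> \<open>The unit vector at \<open>i0\<close>, made orthogonal to the rows in
    \<open>S\<close> by means of their duals \<open>u\<close>; its pairing with row \<open>a\<close>
    is \<open>?g\<close>.\<close>
  define w where "w i = (if i = i0 then 1 else 0) - (\<Sum>b\<in>S. r b i0 * u b i)" for i
  have rw: "(\<Sum>i\<in>I. z i * w i) = z i0 - (\<Sum>b\<in>S. r b i0 * (\<Sum>i\<in>I. z i * u b i))" for z
  proof -
    have "(\<Sum>i\<in>I. z i * w i) = (\<Sum>i\<in>I. if i = i0 then z i else 0)
        - (\<Sum>i\<in>I. \<Sum>b\<in>S. r b i0 * (z i * u b i))"
      unfolding w_def sum_subtractf[symmetric]
      by (rule sum.cong) (auto simp: algebra_simps sum_distrib_left)
    also have "(\<Sum>i\<in>I. \<Sum>b\<in>S. r b i0 * (z i * u b i)) = (\<Sum>b\<in>S. r b i0 * (\<Sum>i\<in>I. z i * u b i))"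
      by (subst sum.swap) (simp add: sum_distrib_left)
    finally show ?thesis using i0 assms(1) by simp
  qed
  have wa: "(\<Sum>i\<in>I. r a i * w i) = ?g"
    unfolding rw c_def by (simp add: mult.commute)
  have wb: "(\<Sum>i\<in>I. r b i * w i) = 0" if "b \<in> S" for b
  proof -
    have "(\<Sum>b'\<in>S. r b' i0 * (\<Sum>i\<in>I. r b i * u b' i)) = (\<Sum>b'\<in>S. if b' = b then r b' i0 else 0)"
      by (rule sum.cong) (auto simp: u that)
    then show ?thesis using that insert.hyps(1) by (simp add: rw)
  qed
  show ?case
  proof (cases "d = a")
    case True
    show ?thesis
    proof (intro exI ballI)
      fix b assume "b \<in> insert a S"
      moreover have "(\<Sum>i\<in>I. r b i * (w i / ?g)) = (\<Sum>i\<in>I. r b i * w i) / ?g"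
        by (simp add: sum_divide_distrib)
      ultimately show "(\<Sum>i\<in>I. r b i * (w i / ?g)) = (if b = d then 1 else 0)"
        using wa wb g True insert.hyps by auto
    qed
  next
    case False
    then have d: "d \<in> S" using insert.prems by simp
    show ?thesis
    proof (intro exI ballI)
      fix b assume b: "b \<in> insert a S"
      \<comment> \<open>Subtracting this multiple of \<open>w\<close> cancels the pairing
        \<open>c d\<close> with row \<open>a\<close> and leaves the pairings with \<open>S\<close>
        unchanged.\<close>
      have "(\<Sum>i\<in>I. r b i * (u d i - c d / ?g * w i))
          = (\<Sum>i\<in>I. r b i * u d i) - c d / ?g * (\<Sum>i\<in>I. r b i * w i)"
        by (simp add: algebra_simps sum_subtractf sum_distrib_left sum_divide_distrib)
      then show "(\<Sum>i\<in>I. r b i * (u d i - c d / ?g * w i)) = (if b = d then 1 else 0)"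
        using b wa wb g False d insert.hyps c_def u by (cases "b = a") auto
    qed
  qed
qed simp

lemma lin_indpt_rows_coeffs_zero:
  fixes B :: "'a::field mat"
  assumes B: "B \<in> carrier_mat m n" and ind: "lin_indpt_rows B"
    and c: "\<And>i. i < n \<Longrightarrow> (\<Sum>j<m. c j * B $$ (j, i)) = 0"
    and "j < m"
  shows "c j = 0"
proof -
  interpret V: vec_space "TYPE('a)" n .
  have inj: "inj_on (row B) {..<m}"
    using ind B unfolding lin_indpt_rows_def rows_def
    by (simp add: distinct_map atLeast0LessThan)
  have set: "set (rows B) = row B ` {..<m}"
    using B by (auto simp: rows_def)
  have carr: "set (rows B) \<subseteq> carrier_vec n"
    using rows_carrier[of B] B by auto
  \<comment> \<open>Distinct rows make \<open>row B\<close> injective, so coefficients indexed by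
    \<open>j\<close> become coefficients on the set of rows.\<close>
  define \<alpha> where "\<alpha> v = c (the_inv_into {..<m} (row B) v)" for v
  have \<alpha>: "\<alpha> (row B j) = c j" if "j < m" for j
    unfolding \<alpha>_def using the_inv_into_f_f[OF inj] that by simp
  have "V.lincomb \<alpha> (set (rows B)) = 0\<^sub>v n"
  proof (rule eq_vecI)
    fix i assume "i < dim_vec (0\<^sub>v n :: 'a vec)"
    then have i: "i < n" by simp
    have "V.lincomb \<alpha> (set (rows B)) $ i = (\<Sum>v\<in>set (rows B). \<alpha> v * v $ i)"
      by (rule V.lincomb_index[OF i carr])
    also have "\<dots> = (\<Sum>j<m. \<alpha> (row B j) * row B j $ i)"
      unfolding set by (simp add: sum.reindex[OF inj])
    also have "\<dots> = (\<Sum>j<m. c j * B $$ (j, i))"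
      by (rule sum.cong) (use i B \<alpha> in auto)
    finally show "V.lincomb \<alpha> (set (rows B)) $ i = 0\<^sub>v n $ i"
      using c i by simp
  qed (use carr V.lincomb_dim in auto)
  moreover have "\<not> V.lin_dep (set (rows B))"
    using ind B unfolding lin_indpt_rows_def by auto
  ultimately have "\<alpha> v = 0" if "v \<in> set (rows B)" for v
    using that unfolding V.lin_dep_def by (auto simp: class_ring_simps)
  then show ?thesis using \<alpha> set \<open>j < m\<close> by force
qed

section \<open>Powers of the Frobenius map on a finite field\<close>

lemma CHAR_eq_prime:
  assumes "prime p" and "CARD('a::{field,finite}) = p ^ k"
  shows "CHAR('a) = p"
proof -
  have "prime CHAR('a)" by (rule prime_CHAR_semidom) (simp add: finite_imp_CHAR_pos)
  moreover have "CHAR('a) dvd p ^ k"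
  proof -
    \<comment> \<open>Translation by 1 permutes the field; comparing both sums shows that its
      cardinality is zero in the field.\<close>
    have "(\<Sum>x\<in>UNIV. x) = (\<Sum>x\<in>UNIV. x + (1::'a))"
      by (rule sum.reindex_bij_witness[of _ "\<lambda>x. x + 1" "\<lambda>x. x - 1"]) auto
    then have "of_nat CARD('a) = (0::'a)" by (simp add: sum.distrib)
    then show ?thesis using assms(2) by (simp only: of_nat_eq_0_iff_char_dvd)
  qed
  ultimately show ?thesis
    using assms(1) by (metis prime_dvd_power primes_dvd_imp_eq)
qed

text \<open>These weights isolate one Frobenius power. They exist because a combination of the
  monomials vanishing on the whole field is a polynomial of degree less than \<open>p ^ k\<close>
  with \<open>p ^ k\<close> roots.\<close>

lemma power_weights_exist:
  fixes k p :: nat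
  assumes "prime p" and "CARD('a::{field,finite}) = p ^ k" and "l < k"
  shows "\<exists>\<beta> :: 'a \<Rightarrow> 'a. \<forall>l'<k. (\<Sum>c\<in>UNIV. c ^ (p ^ l') * \<beta> c) = (if l' = l then 1 else 0)"
proof -
  have p: "p > 1" using assms(1) prime_gt_1_nat by blast
  have "\<exists>\<beta> :: 'a \<Rightarrow> 'a. \<forall>l'\<in>{..<k}. (\<Sum>c\<in>UNIV. c ^ (p ^ l') * \<beta> c) = (if l' = l then 1 else 0)"
  proof (rule dual_vector_exists)
    fix \<gamma> :: "nat \<Rightarrow> 'a"
    assume \<gamma>: "\<And>c. c \<in> UNIV \<Longrightarrow> (\<Sum>l'<k. \<gamma> l' * c ^ (p ^ l')) = 0"
    define P where "P = (\<Sum>l'<k. monom (\<gamma> l') (p ^ l'))"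
    have P0: "poly P c = 0" for c
      using \<gamma> by (simp add: P_def poly_sum poly_monom)
    have "degree P \<le> p ^ (k - 1)"
      unfolding P_def
      by (rule degree_sum_le) (use p in \<open>auto intro!: order.trans[OF degree_monom_le] power_increasing\<close>)
    also have "\<dots> < p ^ k"
      using p assms(3) by (intro power_strict_increasing) auto
    finally have deg: "degree P < CARD('a)" using assms(2) by simp
    have "P = 0"
    proof (rule ccontr)
      assume "P \<noteq> 0"
      then have "card {c. poly P c = 0} \<le> degree P" by (rule card_poly_roots_bound)
      then show False using P0 deg by simp
    qed
    show "\<forall>l'\<in>{..<k}. \<gamma> l' = 0"
    proof
      fix l' assume l': "l' \<in> {..<k}"
      have "coeff P (p ^ l') = (\<Sum>l''<k. if l'' = l' then \<gamma> l'' else 0)"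
        unfolding P_def coeff_sum by (rule sum.cong) (use p in \<open>auto simp: power_inject_exp\<close>)
      then show "\<gamma> l' = 0" using l' \<open>P = 0\<close> by simp
    qed
  qed (use assms in auto)
  then show ?thesis by (simp only: Ball_def lessThan_iff)
qed

section \<open>Packing the pairs \<open>(i, r)\<close> into consecutive blocks of exponents\<close>

lemma block_index:
  fixes t :: "nat \<Rightarrow> nat"
  assumes "i < s" "r < t i"
  shows "(\<Sum>i'<i. t i') + r < (\<Sum>i'<s. t i')"
proof -
  have "(\<Sum>i'<i. t i') + r < (\<Sum>i'<Suc i. t i')" using assms by simp
  also have "\<dots> \<le> (\<Sum>i'<s. t i')" by (rule sum_mono2) (use assms in auto)
  finally show ?thesis .
qed

text \<open>For \<open>i < i'\<close>, every index of block \<open>i\<close> lies below the start of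
  block \<open>i'\<close>, by \<open>block_index\<close> with \<open>i'\<close> as the
  bound.\<close>

lemma block_index_inj:
  fixes t :: "nat \<Rightarrow> nat"
  assumes "r < t i" "r' < t i'" "(\<Sum>h<i. t h) + r = (\<Sum>h<i'. t h) + r'"
  shows "i = i' \<and> r = r'"
proof -
  have "\<not> i < i'" using block_index[of i i' r t] assms by linarith
  moreover have "\<not> i' < i" using block_index[of i' i r' t] assms by linarith
  ultimately have "i = i'" by simp
  with assms(3) show ?thesis by simp
qed

text \<open>Inclusion allows padding up to exactly \<open>t\<close> values; avoiding additional
  values does no harm.\<close>

lemma finite_enumerate_le:
  assumes "finite X" "card X \<le> t"
  shows "\<exists>a. X \<subseteq> a ` {..<t::nat}"
proof -
  obtain a where "X = a ` {..<card X}"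
    using ex_bij_betw_nat_finite[OF assms(1)] by (auto simp: bij_betw_def atLeast0LessThan)
  then show ?thesis using assms(2) by (metis image_mono lessThan_subset_iff)
qed

section \<open>Assembling the dual system over the triples \<open>(i, r, j)\<close>\<close>

theorem theorem3p1:
  fixes p k s n :: nat
    and m t :: "nat \<Rightarrow> nat"
    and B :: "nat \<Rightarrow> 'a::{field,finite} mat"
    and T :: "nat \<Rightarrow> nat \<Rightarrow> 'a set"
  assumes "prime p" and "k \<ge> 1" and "CARD('a) = p ^ k"
    and "s \<ge> 1" and "n \<ge> 1"
    and "\<And>i. i < s \<Longrightarrow> B i \<in> carrier_mat (m i) n"
    and "\<And>i. i < s \<Longrightarrow> lin_indpt_rows (B i)"
    and "\<And>i j. i < s \<Longrightarrow> j < m i \<Longrightarrow> card (T i j) \<le> t i"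
    and "(\<Sum>i<s. t i) \<le> k"
  shows "\<exists>x \<in> carrier_vec n. \<forall>i<s. \<forall>j<m i. (B i *\<^sub>v x) $ j \<notin> T i j"
proof -
  define e where "e i r = (\<Sum>h<i. t h) + r" for i r
  have e_less: "e i r < k" if "i < s" "r < t i" for i r
    using block_index[of i s r t, OF that] assms(9) by (simp add: e_def)
  have "\<forall>i j. \<exists>a. i < s \<longrightarrow> j < m i \<longrightarrow> T i j \<subseteq> a ` {..<t i}"
    using assms(8) finite_enumerate_le finite by metis
  then obtain a where a: "\<And>i j. i < s \<Longrightarrow> j < m i \<Longrightarrow> T i j \<subseteq> a i j ` {..<t i}"
    by metis
  \<comment> \<open>Functions on \<open>nat\<close> stand in for vectors, so that additivity holds
    without a dimension condition; only coordinates below \<open>n\<close> matter.\<close>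
  define L where "L i j x = (\<Sum>l<n. B i $$ (j, l) * x l)" for i j and x :: "nat \<Rightarrow> 'a"
  define A where "A = (\<lambda>(i, r, j) x. L i j x ^ (p ^ e i r))"
  define S where "S = (SIGMA i:{..<s}. {..<t i} \<times> {..<m i})"
  have "\<exists>x. \<forall>b\<in>S. A b x \<noteq> (case b of (i, r, j) \<Rightarrow> a i j r ^ (p ^ e i r))"
  proof (rule additive_avoids_values)
    show "finite S" by (simp add: S_def)
  next
    fix b and x v :: "nat \<Rightarrow> 'a"
    have "L i j (x + v) = L i j x + L i j v" for i j
      by (simp add: L_def algebra_simps sum.distrib)
    moreover have "(y + z) ^ (p ^ l) = y ^ (p ^ l) + z ^ (p ^ l)" for y z :: 'a and l
      using CHAR_eq_prime[OF assms(1,3)] assms(1)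
      by (intro freshmans_dream'[where m = "p ^ l" and n = l]) simp_all
    ultimately show "A b (x + v) = A b x + A b v"
      by (simp add: A_def split: prod.split)
  next
    fix b assume "b \<in> S"
    then obtain i r j where b: "b = (i, r, j)" "i < s" "r < t i" "j < m i"
      by (auto simp: S_def)
    have "\<exists>u. \<forall>j'\<in>{..<m i}. (\<Sum>l\<in>{..<n}. B i $$ (j', l) * u l) = (if j' = j then 1 else 0)"
      by (rule dual_vector_exists)
        (use b lin_indpt_rows_coeffs_zero[OF assms(6)[OF b(2)] assms(7)[OF b(2)]] in auto)
    then obtain u where u: "\<And>j'. j' < m i \<Longrightarrow> L i j' u = (if j' = j then 1 else 0)"
      by (auto simp: L_def)
    obtain \<beta> :: "'a \<Rightarrow> 'a" where
      \<beta>: "\<And>l. l < k \<Longrightarrow> (\<Sum>c\<in>UNIV. c ^ (p ^ l) * \<beta> c) = (if l = e i r then 1 else 0)"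
      using power_weights_exist[OF assms(1,3) e_less[OF b(2,3)]] by blast
    have L_scale: "L i' j' (\<lambda>l. c * u l) = c * L i' j' u" for i' j' c
      by (simp add: L_def sum_distrib_left algebra_simps)
    \<comment> \<open>The dual combination consists of the multiples \<open>c * u\<close> weighted
      by \<open>\<beta> c\<close>. For \<open>i' \<noteq> i\<close> nothing is known about
      \<open>L i' j' u\<close>, but the exponents differ and the weighted power sum is zero.\<close>
    have "(\<Sum>c\<in>UNIV. \<beta> c * A b' (\<lambda>l. c * u l)) = (if b' = b then 1 else 0)" if b'S: "b' \<in> S" for b'
    proof -
      obtain i' r' j' where b': "b' = (i', r', j')" "i' < s" "r' < t i'" "j' < m i'"
        using b'S by (auto simp: S_def)
      have "(\<Sum>c\<in>UNIV. \<beta> c * A b' (\<lambda>l. c * u l))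
          = (\<Sum>c\<in>UNIV. c ^ (p ^ e i' r') * \<beta> c) * L i' j' u ^ (p ^ e i' r')"
        unfolding sum_distrib_right
        by (rule sum.cong) (simp_all add: A_def b' L_scale power_mult_distrib ac_simps)
      also have "\<dots> = (if e i' r' = e i r then 1 else 0) * L i' j' u ^ (p ^ e i' r')"
        by (simp add: \<beta> e_less b')
      also have "e i' r' = e i r \<longleftrightarrow> i' = i \<and> r' = r"
        using block_index_inj[of r' t i' r i] b b' by (auto simp: e_def)
      \<comment> \<open>For equal exponents \<open>u\<close> separates \<open>j'\<close> from
        \<open>j\<close>; the power of 0 vanishes because \<open>p ^ e i r\<close> is
        positive.\<close>
      finally show ?thesis
        using b b' u prime_gt_0_nat[OF assms(1)] by (auto simp: power_0_left)
    qed
    then show "\<exists>(I::'a set) \<beta> w. \<forall>b'\<in>S. (\<Sum>c\<in>I. \<beta> c * A b' (w c)) = (if b' = b then 1 else 0)"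
      by (intro exI[of _ UNIV] exI[of _ \<beta>] exI[of _ "\<lambda>c l. c * u l"]) blast
  qed
  then obtain x where x: "\<forall>b\<in>S. A b x \<noteq> (case b of (i, r, j) \<Rightarrow> a i j r ^ (p ^ e i r))"
    by blast
  have avoid: "\<And>i r j. i < s \<Longrightarrow> r < t i \<Longrightarrow> j < m i \<Longrightarrow>
      L i j x ^ (p ^ e i r) \<noteq> a i j r ^ (p ^ e i r)"
  proof -
    fix i r j assume "i < s" "r < t i" "j < m i"
    then have "(i, r, j) \<in> S" by (simp add: S_def)
    with x show "L i j x ^ (p ^ e i r) \<noteq> a i j r ^ (p ^ e i r)" by (auto simp: A_def)
  qed
  have Bx: "(B i *\<^sub>v vec n x) $ j = L i j x" if "i < s" "j < m i" for i j
    using assms(6)[OF that(1)] that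
    by (simp add: L_def scalar_prod_def atLeast0LessThan)
  have "\<forall>i<s. \<forall>j<m i. (B i *\<^sub>v vec n x) $ j \<notin> T i j"
  proof (intro allI impI notI)
    fix i j assume ij: "i < s" "j < m i" and "(B i *\<^sub>v vec n x) $ j \<in> T i j"
    then obtain r where "r < t i" "L i j x = a i j r"
      using a[OF ij] Bx[OF ij] by auto
    then show False using avoid[OF ij(1) _ ij(2)] by metis
  qed
  then show ?thesis by (intro bexI[of _ "vec n x"]) auto
qed

end
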